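(* In the setting and notation of the context, assume $\mathcal{P}>0$ and let $R_s>0$. Let $$\gamma_P=\frac{c\,h}{d\,\alpha+1},\qquad \gamma_E=\frac{c\,f}{d\,\varphi+1},$$ let $C_{\text{sec}}=B\log_2(1+\gamma_P)-B\log_2(1+\gamma_E)$ if $\gamma_P\ge\gamma_E$ and $C_{\text{sec}}=0$ if $\gamma_P<\gamma_E$, and let $P_{\text{out,sec}}=\Pr\{C_{\text{sec}}<R_s\}$. Put $$\xi=2^{R_s/B},\quad A_0=\frac{d\,\Omega_\alpha}{c\,\Omega_h},\quad B_0=c\,\Omega_h,\quad D_0=\frac{d\,\Omega_\varphi}{c\,\Omega_f},\quad E_0=c\,\Omega_f,$$ $$A_1=\frac{\exp\left(-\frac{\xi-1}{B_0}\right)}{1+A_0(\xi-1)},\quad D_1=\frac{A_0\xi}{1+A_0(\xi-1)},\quad \frac1{B_1}=\frac{\xi}{B_0}+\frac1{E_0}.$$ Then: (i) if $D_1=D_0$, $$\begin{aligned}P_{\text{out,sec}}=&1-\frac{A_1}{2}+\frac{A_1}{2D_0B_1}-\frac{A_1}{2D_0^2B_1^2}\exp\left(\frac1{D_0B_1}\right)\Gamma\left[0,\frac1{D_0B_1}\right]\\&-\frac{A_1}{D_0E_0}-\frac{A_1}{D_0^2E_0B_1}\exp\left(\frac1{D_0B_1}\right)\mathrm{Ei}\left(-\frac1{D_0B_1}\right);\end{aligned}$$ (ii) if $D_1\neq D_0$, $$\begin{aligned}P_{\text{out,sec}}=&1-\frac{D_0A_1}{D_0-D_1}-\frac{A_1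}{B_1(D_0-D_1)}\exp\left(\frac1{D_0B_1}\right)\mathrm{Ei}\left(-\frac1{D_0B_1}\right)\\&+\frac{A_1D_0D_1}{(D_0-D_1)^2}\left\{\exp\left(\frac1{D_0B_1}\right)\Gamma\left[0,\frac1{D_0B_1}\right]-\exp\left(\frac1{B_1D_1}\right)\Gamma\left[0,\frac1{B_1D_1}\right]\right\}\\&+\frac{A_1}{E_0(D_0-D_1)}\left\{\exp\left(\frac1{B_1D_1}\right)\Gamma\left[0,\frac1{B_1D_1}\right]-\exp\left(\frac1{D_0B_1}\right)\Gamma\left[0,\frac1{D_0B_1}\right]\right\}.\end{aligned}$$
   Context: $P_p,N_0,B,r_p,P_{\text{pk}}>0$ and $\theta_{th}\in(0,1)$ are constants (primary transmit power, noise power, bandwidth, primary target rate, secondary peak power, primary outage threshold). The channel power gains $h$ (primary transmitter to primary receiver), $\alpha$ (secondary transmitter to primary receiver), $f$ (primary transmitter to eavesdropper), $\varphi$ (secondary transmitter to eavesdropper) are mutually independent exponential random variables with means $\Omega_h,\Omega_\alpha,\Omega_f,\Omega_\varphi>0$. The secondary transmitter uses the deterministic power $$\mathcal{P}=\min\left\{\frac{P_p\Omega_h}{\gamma_{th}\Omega_\alpha}\chi^{+},P_{\text{pk}}\right\},\quad \gamma_{th}=2^{r_p/B}-1,\quad \chi^{+}=\max\left\{\frac{1}{1-\theta_{th}}\exp\left(-\frac{N_0\gamma_{th}}{P_p\Omega_h}\right)-1,0\right\}.$$ Set $c=P_p/N_0$ and $d=\mathcal{P}/N_0$. $\gamma_P$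 and $\gamma_E$ are the signal-to-interference-plus-noise ratios at the primary receiver and the eavesdropper, $C_{\text{sec}}$ is the secrecy capacity of the primary user, $R_s$ is the secrecy target rate, and $P_{\text{out,sec}}$ is the outage probability of secrecy capacity. For $z>0$, $\Gamma[0,z]=\int_z^\infty \frac{e^{-t}}{t}\,dt$ (incomplete gamma function) and $\mathrm{Ei}(-z)=-\Gamma[0,z]$ (exponential integral). *)

theory Defs
  imports "HOL-Probability.Probability"
begin

text \<open>\<open>\<Gamma>[0, z]\<close> and \<open>Ei\<close>; only meaningful for \<open>z > 0\<close> and for \<open>x < 0\<close>, respectively.\<close>

definition Gamma0 :: "real \<Rightarrow> real" where
  "Gamma0 z = (LBINT t:{z<..}. exp (- t) / t)"

definition Ei :: "real \<Rightarrow> real" where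
  "Ei x = - Gamma0 (- x)"

definition sinr_threshold :: "real \<Rightarrow> real \<Rightarrow> real" where
  "sinr_threshold B r\<^sub>p = 2 powr (r\<^sub>p / B) - 1"

definition chi_plus :: "real \<Rightarrow> real \<Rightarrow> real \<Rightarrow> real \<Rightarrow> real \<Rightarrow> real" where
  "chi_plus P\<^sub>p N\<^sub>0 \<theta> \<gamma> \<Omega>\<^sub>h = max (1 / (1 - \<theta>) * exp (- (N\<^sub>0 * \<gamma>) / (P\<^sub>p * \<Omega>\<^sub>h)) - 1) 0"

definition secondary_power ::
  "real \<Rightarrow> real \<Rightarrow> real \<Rightarrow> real \<Rightarrow> real \<Rightarrow> real \<Rightarrow> real \<Rightarrow> real \<Rightarrow> real" where
  "secondary_power P\<^sub>p N\<^sub>0 B r\<^sub>p P\<^sub>p\<^sub>k \<theta> \<Omega>\<^sub>h \<Omega>\<^sub>\<alpha> =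
     (let \<gamma> = sinr_threshold B r\<^sub>p
      in min (P\<^sub>p * \<Omega>\<^sub>h / (\<gamma> * \<Omega>\<^sub>\<alpha>) * chi_plus P\<^sub>p N\<^sub>0 \<theta> \<gamma> \<Omega>\<^sub>h) P\<^sub>p\<^sub>k)"

definition secrecy_capacity :: "real \<Rightarrow> real \<Rightarrow> real \<Rightarrow> real" where
  "secrecy_capacity B \<gamma>\<^sub>P \<gamma>\<^sub>E =
     (if \<gamma>\<^sub>P \<ge> \<gamma>\<^sub>E then B * log 2 (1 + \<gamma>\<^sub>P) - B * log 2 (1 + \<gamma>\<^sub>E) else 0)"

definition secrecy_outage ::
  "'a measure \<Rightarrow> real \<Rightarrow> real \<Rightarrow> ('a \<Rightarrow> real) \<Rightarrow> ('a \<Rightarrow> real) \<Rightarrow> real" where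
  "secrecy_outage M B R\<^sub>s \<gamma>\<^sub>P \<gamma>\<^sub>E =
     measure M {\<omega> \<in> space M. secrecy_capacity B (\<gamma>\<^sub>P \<omega>) (\<gamma>\<^sub>E \<omega>) < R\<^sub>s}"

text \<open>\<open>exponential_density\<close> takes the rate, so the mean \<open>\<Omega>\<close> corresponds to the rate \<open>1 / \<Omega>\<close>.\<close>

definition exponential_rv :: "'a measure \<Rightarrow> ('a \<Rightarrow> real) \<Rightarrow> real \<Rightarrow> bool" where
  "exponential_rv M X \<Omega> \<longleftrightarrow> distributed M lborel X (exponential_density (1 / \<Omega>))"

end

theory Submission
  imports Defs "HOL-Real_Asymp.Real_Asymp"
begin

text \<open>Conditioning on the interference gives the tail
  \<open>Pr(\<gamma> > x) = exp (- x / a) / (1 + b x)\<close> of both SINRs, and differentiating it gives the density of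
  \<open>\<gamma>\<^sub>E\<close>. Almost surely, there is no outage iff \<open>\<gamma>\<^sub>P \<ge> \<xi> - 1 + \<xi> \<gamma>\<^sub>E\<close>; by independence this has
  probability \<open>\<integral> Pr(\<gamma>\<^sub>P \<ge> \<xi> - 1 + \<xi> y) p\<^sub>E(y) dy\<close>. Partial fractions reduce this to the integrals
  \<open>I\<^sub>n = \<integral>\<^sub>0\<^sup>\<infinity> exp (- s y) / (1 + D y) ^ n dy\<close>. Here \<open>I\<^sub>1\<close> is an incomplete gamma function after the
  substitution \<open>t = s / D + s y\<close>, and integration by parts yields \<open>n D I\<^sub>n\<^sub>+\<^sub>1 = 1 - s I\<^sub>n\<close>.\<close>

section \<open>Conditioning on an independent random variable\<close>

text \<open>Independence makes the joint law the product of the two marginal laws, so the measure of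
  the relation is the integral of the measures of its sections.\<close>

lemma (in prob_space) emeasure_indep_rel:
  assumes ind: "indep_var S X T Y" and Q: "Measurable.pred (S \<Otimes>\<^sub>M T) (\<lambda>(x, y). Q x y)"
  shows "emeasure M {\<omega> \<in> space M. Q (X \<omega>) (Y \<omega>)} =
    (\<integral>\<^sup>+y. emeasure M {\<omega> \<in> space M. Q (X \<omega>) y} \<partial>distr M T Y)"
proof -
  have X[measurable]: "random_variable S X" and Y[measurable]: "random_variable T Y"
    and eq: "distr M S X \<Otimes>\<^sub>M distr M T Y = distr M (S \<Otimes>\<^sub>M T) (\<lambda>x. (X x, Y x))"
    using ind unfolding indep_var_distribution_eq by auto
  interpret DX: prob_space "distr M S X" by (rule prob_space_distr) fact
  interpret DY: prob_space "distr M T Y" by (rule prob_space_distr) fact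
  interpret pair_sigma_finite "distr M S X" "distr M T Y" ..
  let ?A = "{p \<in> space (S \<Otimes>\<^sub>M T). Q (fst p) (snd p)}"
  have A: "?A \<in> sets (S \<Otimes>\<^sub>M T)"
    using Q by (auto simp: pred_def split_beta')
  have "emeasure M {\<omega> \<in> space M. Q (X \<omega>) (Y \<omega>)} = emeasure (distr M (S \<Otimes>\<^sub>M T) (\<lambda>x. (X x, Y x))) ?A"
    using measurable_space[OF X] measurable_space[OF Y]
    by (subst emeasure_distr[OF _ A]) (auto simp: space_pair_measure intro!: arg_cong[where f="emeasure M"])
  also have "\<dots> = (\<integral>\<^sup>+y. emeasure (distr M S X) ((\<lambda>x. (x, y)) -` ?A) \<partial>distr M T Y)"
    unfolding eq[symmetric] using A by (intro emeasure_pair_measure_alt2) simp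
  also have "\<dots> = (\<integral>\<^sup>+y. emeasure M {\<omega> \<in> space M. Q (X \<omega>) y} \<partial>distr M T Y)"
  proof (intro nn_integral_cong)
    fix y assume y: "y \<in> space (distr M T Y)"
    have "(\<lambda>x. (x, y)) -` ?A \<in> sets S"
      using sets_Pair2[OF A, of y] by simp
    then show "emeasure (distr M S X) ((\<lambda>x. (x, y)) -` ?A) = emeasure M {\<omega> \<in> space M. Q (X \<omega>) y}"
      using y measurable_space[OF X]
      by (subst emeasure_distr[OF X]) (auto simp: space_pair_measure intro!: arg_cong[where f="emeasure M"])
  qed
  finally show ?thesis .
qed

text \<open>The form in which conditioning is applied twice: to the interference inside one SINR,
  and then to the eavesdropper's SINR. The density vanishes on the negative axis, so the section
  probabilities \<open>F\<close> have to be known for \<open>0 \<le> y\<close> only.\<close>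

lemma (in prob_space) emeasure_indep_rel_density:
  fixes k F :: "real \<Rightarrow> real"
  assumes ind: "indep_var S X borel Y" and Q: "Measurable.pred (S \<Otimes>\<^sub>M borel) (\<lambda>(x, y). Q x y)"
    and Y: "distributed M lborel Y (\<lambda>y. indicator {0..} y * k y)"
    and k: "\<And>y. 0 \<le> y \<Longrightarrow> 0 \<le> k y"
    and F: "\<And>y. 0 \<le> y \<Longrightarrow> emeasure M {\<omega> \<in> space M. Q (X \<omega>) y} = ennreal (F y)"
    and F_borel[measurable]: "F \<in> borel_measurable borel"
  shows "emeasure M {\<omega> \<in> space M. Q (X \<omega>) (Y \<omega>)} =
    (\<integral>\<^sup>+y. ennreal (k y * F y) * indicator {0..} y \<partial>lborel)"
proof -
  let ?g = "\<lambda>y. ennreal (indicator {0..} y * k y)"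
  have D: "distr M borel Y = density lborel ?g"
    using distributed_distr_eq_density[OF Y] by (simp cong: distr_cong)
  have g[measurable]: "?g \<in> borel_measurable borel"
    using distributed_borel_measurable[OF Y] by simp
  have "emeasure M {\<omega> \<in> space M. Q (X \<omega>) (Y \<omega>)} =
      (\<integral>\<^sup>+y. emeasure M {\<omega> \<in> space M. Q (X \<omega>) y} \<partial>density lborel ?g)"
    using emeasure_indep_rel[OF ind Q] by (simp add: D)
  also have "\<dots> = (\<integral>\<^sup>+y. ennreal (F y) \<partial>density lborel ?g)"
    by (intro nn_integral_cong_AE)
       (auto simp: AE_density F split: split_indicator intro!: AE_I2)
  also have "\<dots> = (\<integral>\<^sup>+y. ?g y * ennreal (F y) \<partial>lborel)"
    by (intro nn_integral_density) auto
  also have "\<dots> = (\<integral>\<^sup>+y. ennreal (k y * F y) * indicator {0..} y \<partial>lborel)"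
    by (intro nn_integral_cong) (auto simp: k ennreal_mult' split: split_indicator)
  finally show ?thesis .
qed

section \<open>The law of a single SINR\<close>

text \<open>Tail and density of \<open>c X / (d Y + 1)\<close> for independent exponential \<open>X\<close>, \<open>Y\<close>, where
  \<open>a = c \<Omega>\<^sub>X\<close> and \<open>b = d \<Omega>\<^sub>Y / (c \<Omega>\<^sub>X)\<close>; only meaningful for \<open>x \<ge> 0\<close>.\<close>

definition sinr_ccdf :: "real \<Rightarrow> real \<Rightarrow> real \<Rightarrow> real" where
  "sinr_ccdf a b x = exp (- (x / a)) / (1 + b * x)"

definition sinr_pdf :: "real \<Rightarrow> real \<Rightarrow> real \<Rightarrow> real" where
  "sinr_pdf a b x = exp (- (x / a)) * (1 / a / (1 + b * x) + b / (1 + b * x)\<^sup>2)"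

lemma exponential_density_alt: "exponential_density l = (\<lambda>y. indicator {0..} y * (l * exp (- (l * y))))"
  by (auto simp: exponential_density_def fun_eq_iff algebra_simps split: split_indicator)

text \<open>Working with the nonnegative integral lets the same computation serve two ends: the
  value of a probability, and later the integrability of the dominating function
  \<open>exp (- (s * y))\<close>.\<close>

lemma nn_integral_exponential_tail:
  fixes s k :: real
  assumes "0 < s" "0 \<le> k"
  shows "(\<integral>\<^sup>+y. ennreal (k * exp (- (s * y))) * indicator {0..} y \<partial>lborel) = ennreal (k / s)"
proof -
  have lim: "((\<lambda>y. - (k / s) * exp (- (s * y))) \<longlongrightarrow> - (k / s) * 0) at_top"
    using assms
    by (intro tendsto_mult tendsto_const filterlim_compose[OF exp_at_bot]
          filterlim_compose[OF filterlim_uminus_at_bot_at_top] filterlim_tendsto_pos_mult_at_top[OF tendsto_const _ filterlim_ident])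
  show ?thesis
    using assms by (subst nn_integral_FTC_atLeast[OF _ _ _ lim]) (auto intro!: derivative_eq_intros)
qed

text \<open>For a fixed interference value \<open>y\<close> the event says that \<open>X\<close>
  exceeds \<open>x * (d * y + 1) / c\<close>, whose probability is again exponential in
  \<open>y\<close>. Averaging over \<open>Y\<close> therefore integrates a single
  exponential.\<close>

lemma (in prob_space) emeasure_sinr_gt:
  fixes X Y :: "'a \<Rightarrow> real"
  assumes ind: "indep_var borel X borel Y"
    and X: "exponential_rv M X \<Omega>\<^sub>X" and Y: "exponential_rv M Y \<Omega>\<^sub>Y"
    and pos: "0 < \<Omega>\<^sub>X" "0 < \<Omega>\<^sub>Y" "0 < c" "0 < d" and x: "0 \<le> x"
  shows "emeasure M {\<omega> \<in> space M. x < c * X \<omega> / (d * Y \<omega> + 1)} =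
    ennreal (sinr_ccdf (c * \<Omega>\<^sub>X) (d * \<Omega>\<^sub>Y / (c * \<Omega>\<^sub>X)) x)"
proof -
  let ?F = "\<lambda>y. exp (- (x * (d * y + 1) / (c * \<Omega>\<^sub>X)))"
  \<comment> \<open>The combined decay rate in \<open>y\<close>: the rate of \<open>Y\<close> plus
    the coefficient of \<open>y\<close> in the exponent of \<open>?F\<close>.\<close>
  let ?s = "1 / \<Omega>\<^sub>Y + x * d / (c * \<Omega>\<^sub>X)"
  have F: "emeasure M {\<omega> \<in> space M. x < c * X \<omega> / (d * y + 1)} = ennreal (?F y)"
    if y: "0 \<le> y" for y
  proof -
    have "d * y + 1 > 0" using y pos by (simp add: add_nonneg_pos)
    then have "{\<omega> \<in> space M. x < c * X \<omega> / (d * y + 1)} = {\<omega> \<in> space M. x * (d * y + 1) / c < X \<omega>}"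
      using pos y by (auto simp: field_simps)
    moreover have "prob {\<omega> \<in> space M. x * (d * y + 1) / c < X \<omega>} = ?F y"
      using exponential_distributedD_gt[OF X[unfolded exponential_rv_def], of "x * (d * y + 1) / c"] pos x y
      by simp
    ultimately show ?thesis by (simp add: emeasure_eq_measure)
  qed
  have Y': "distributed M lborel Y (\<lambda>y. indicator {0..} y * (1 / \<Omega>\<^sub>Y * exp (- (1 / \<Omega>\<^sub>Y * y))))"
    using Y by (simp add: exponential_rv_def exponential_density_alt)
  have "emeasure M {\<omega> \<in> space M. x < c * X \<omega> / (d * Y \<omega> + 1)} =
    (\<integral>\<^sup>+y. ennreal (1 / \<Omega>\<^sub>Y * exp (- (1 / \<Omega>\<^sub>Y * y)) * ?F y) * indicator {0..} y \<partial>lborel)"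
    by (rule emeasure_indep_rel_density[OF ind _ Y' _ F]) (use pos in auto)
  also have "\<dots> = (\<integral>\<^sup>+y. ennreal (1 / \<Omega>\<^sub>Y * exp (- (x / (c * \<Omega>\<^sub>X))) * exp (- (?s * y))) * indicator {0..} y \<partial>lborel)"
  proof (intro nn_integral_cong)
    fix y
    have e: "- (1 / \<Omega>\<^sub>Y * y) + - (x * (d * y + 1) / (c * \<Omega>\<^sub>X)) = - (x / (c * \<Omega>\<^sub>X)) + - (?s * y)"
      using pos by (simp add: field_simps)
    show "ennreal (1 / \<Omega>\<^sub>Y * exp (- (1 / \<Omega>\<^sub>Y * y)) * ?F y) * indicator {0..} y =
      ennreal (1 / \<Omega>\<^sub>Y * exp (- (x / (c * \<Omega>\<^sub>X))) * exp (- (?s * y))) * indicator {0..} y"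
      by (simp only: mult.assoc exp_add[symmetric] e)
  qed
  also have "\<dots> = ennreal (1 / \<Omega>\<^sub>Y * exp (- (x / (c * \<Omega>\<^sub>X))) / ?s)"
    using pos x by (intro nn_integral_exponential_tail) (auto simp: add_pos_nonneg)
  also have "1 / \<Omega>\<^sub>Y * exp (- (x / (c * \<Omega>\<^sub>X))) / ?s = sinr_ccdf (c * \<Omega>\<^sub>X) (d * \<Omega>\<^sub>Y / (c * \<Omega>\<^sub>X)) x"
  proof -
    have "\<Omega>\<^sub>Y * ?s = 1 + d * \<Omega>\<^sub>Y / (c * \<Omega>\<^sub>X) * x" using pos by (simp add: field_simps)
    then show ?thesis unfolding sinr_ccdf_def by (metis (no_types) divide_divide_eq_left mult.commute times_divide_eq_left mult_1)
  qed
  finally show ?thesis .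
qed

lemma has_field_derivative_sinr_ccdf:
  assumes "0 < a" "0 < b" "0 \<le> x"
  shows "((\<lambda>x. - sinr_ccdf a b x) has_real_derivative sinr_pdf a b x) (at x)"
proof -
  have nz: "1 + b * x \<noteq> 0" using assms by (smt (verit) mult_nonneg_nonneg)
  have "((\<lambda>x. - sinr_ccdf a b x) has_real_derivative
      - ((exp (- (x / a)) * - (1 / a) * (1 + b * x) - exp (- (x / a)) * b) / ((1 + b * x) * (1 + b * x)))) (at x)"
    unfolding sinr_ccdf_def using assms nz
    by (auto intro!: derivative_eq_intros)
  also have "- ((exp (- (x / a)) * - (1 / a) * (1 + b * x) - exp (- (x / a)) * b) / ((1 + b * x) * (1 + b * x))) =
      sinr_pdf a b x"
    unfolding sinr_pdf_def power2_eq_square using nz assms(1) by (simp add: divide_simps) (simp add: algebra_simps)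
  finally show ?thesis .
qed

lemma sinr_pdf_nonneg: "0 < a \<Longrightarrow> 0 < b \<Longrightarrow> 0 \<le> x \<Longrightarrow> 0 \<le> sinr_pdf a b x"
  by (simp add: sinr_pdf_def)

lemma sinr_ccdf_nonneg: "0 < b \<Longrightarrow> 0 \<le> x \<Longrightarrow> 0 \<le> sinr_ccdf a b x"
  by (simp add: sinr_ccdf_def)

lemma borel_measurable_sinr_pdf[measurable]: "sinr_pdf a b \<in> borel_measurable borel"
  unfolding sinr_pdf_def by measurable

lemma borel_measurable_sinr_ccdf[measurable]: "sinr_ccdf a b \<in> borel_measurable borel"
  unfolding sinr_ccdf_def by measurable

text \<open>A law on the reals is determined by its distribution function. Here that is 1 minus the
  tail on the nonnegative axis, and the fundamental theorem of calculus recovers it from the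
  proposed density.\<close>

lemma (in prob_space) distributed_sinr:
  fixes X Y :: "'a \<Rightarrow> real"
  assumes ind: "indep_var borel X borel Y"
    and X: "exponential_rv M X \<Omega>\<^sub>X" and Y: "exponential_rv M Y \<Omega>\<^sub>Y"
    and pos: "0 < \<Omega>\<^sub>X" "0 < \<Omega>\<^sub>Y" "0 < c" "0 < d"
  shows "distributed M lborel (\<lambda>\<omega>. c * X \<omega> / (d * Y \<omega> + 1))
    (\<lambda>y. indicator {0..} y * sinr_pdf (c * \<Omega>\<^sub>X) (d * \<Omega>\<^sub>Y / (c * \<Omega>\<^sub>X)) y)"
proof -
  define a where "a = c * \<Omega>\<^sub>X"
  define b where "b = d * \<Omega>\<^sub>Y / (c * \<Omega>\<^sub>X)"
  have ab: "0 < a" "0 < b" using pos by (auto simp: a_def b_def)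
  let ?Z = "\<lambda>\<omega>. c * X \<omega> / (d * Y \<omega> + 1)"
  let ?G = "\<lambda>z. if z < 0 then 0 else 1 - sinr_ccdf a b z"
  have [measurable]: "random_variable borel X" "random_variable borel Y"
    using indep_var_rv1[OF ind] indep_var_rv2[OF ind] by auto
  have le: "emeasure M {\<omega> \<in> space M. ?Z \<omega> \<le> z} = ennreal (1 - sinr_ccdf a b z)" if "0 \<le> z" for z
  proof -
    have "prob {\<omega> \<in> space M. z < ?Z \<omega>} = sinr_ccdf a b z"
      using emeasure_sinr_gt[OF ind X Y pos that] sinr_ccdf_nonneg[OF ab(2) that, of a]
      by (simp add: a_def b_def emeasure_eq_measure)
    then have "prob {\<omega> \<in> space M. \<not> z < ?Z \<omega>} = 1 - sinr_ccdf a b z"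
      by (subst prob_neg) auto
    then show ?thesis by (simp add: emeasure_eq_measure not_less)
  qed
  have "distributed M lborel ?Z (\<lambda>y. indicator {0..} y * sinr_pdf a b y)"
  proof (rule distributedI_borel_atMost[where g="?G"])
    show "AE x in lborel. 0 \<le> indicator {0..} x * sinr_pdf a b x"
      by (auto simp: sinr_pdf_nonneg ab split: split_indicator)
    fix z
    show "emeasure M {\<omega> \<in> space M. ?Z \<omega> \<le> z} = ennreal (?G z)"
    proof (cases "z < 0")
      case True
      \<comment> \<open>The tail formula covers nonnegative arguments only. A negative
        \<open>z\<close> is handled by monotonicity, since the event for 0 is already null.\<close>
      then have "emeasure M {\<omega> \<in> space M. ?Z \<omega> \<le> z} \<le> emeasure M {\<omega> \<in> space M. ?Z \<omega> \<le> 0}"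
        by (intro emeasure_mono) auto
      also have "\<dots> = 0" using le[of 0] by (simp add: sinr_ccdf_def)
      finally show ?thesis using True by simp
    qed (simp add: le)
    show "(\<integral>\<^sup>+x. ennreal (indicator {0..} x * sinr_pdf a b x * indicator {..z} x) \<partial>lborel) = ennreal (?G z)"
    proof (cases "z < 0")
      case True
      then show ?thesis by (auto intro!: nn_integral_zero' AE_I2 split: split_indicator)
    next
      case False
      have "(\<integral>\<^sup>+x. ennreal (indicator {0..} x * sinr_pdf a b x * indicator {..z} x) \<partial>lborel) =
          (\<integral>\<^sup>+x. ennreal (sinr_pdf a b x) * indicator {0..z} x \<partial>lborel)"
        by (intro nn_integral_cong) (auto split: split_indicator)
      also have "\<dots> = ennreal (- sinr_ccdf a b z - - sinr_ccdf a b 0)"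
        using False ab
        by (intro nn_integral_FTC_Icc)
           (auto intro!: has_field_derivative_at_within[OF has_field_derivative_sinr_ccdf] sinr_pdf_nonneg)
      also have "\<dots> = ennreal (?G z)" using False by (simp add: sinr_ccdf_def)
      finally show ?thesis .
    qed
  qed measurable
  then show ?thesis by (simp add: a_def b_def)
qed

text \<open>A law with a Lebesgue density has no atoms; this makes strict and non-strict tails
  agree.\<close>

lemma (in prob_space) AE_distributed_lborel_neq:
  fixes X :: "'a \<Rightarrow> real"
  assumes "distributed M lborel X f"
  shows "AE \<omega> in M. X \<omega> \<noteq> t"
proof -
  have [measurable]: "X \<in> borel_measurable M" using distributed_measurable[OF assms] by simp
  have "AE x in density lborel f. x \<noteq> t"
    using distributed_borel_measurable[OF assms]
    by (subst AE_density) (auto intro: AE_mp[OF AE_lborel_singleton])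
  then have "AE x in distr M lborel X. x \<noteq> t"
    unfolding distributed_distr_eq_density[OF assms] .
  then show ?thesis by (subst (asm) AE_distr_iff) auto
qed

text \<open>The complement of the outage event is a non-strict inequality, whereas the tail was
  computed for a strict one.\<close>

lemma (in prob_space) emeasure_sinr_ge:
  fixes X Y :: "'a \<Rightarrow> real"
  assumes ind: "indep_var borel X borel Y"
    and X: "exponential_rv M X \<Omega>\<^sub>X" and Y: "exponential_rv M Y \<Omega>\<^sub>Y"
    and pos: "0 < \<Omega>\<^sub>X" "0 < \<Omega>\<^sub>Y" "0 < c" "0 < d" and x: "0 \<le> x"
  shows "emeasure M {\<omega> \<in> space M. x \<le> c * X \<omega> / (d * Y \<omega> + 1)} =
    ennreal (sinr_ccdf (c * \<Omega>\<^sub>X) (d * \<Omega>\<^sub>Y / (c * \<Omega>\<^sub>X)) x)"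
proof -
  have [measurable]: "random_variable borel X" "random_variable borel Y"
    using indep_var_rv1[OF ind] indep_var_rv2[OF ind] by auto
  have "emeasure M {\<omega> \<in> space M. x \<le> c * X \<omega> / (d * Y \<omega> + 1)} =
      emeasure M {\<omega> \<in> space M. x < c * X \<omega> / (d * Y \<omega> + 1)}"
    using AE_distributed_lborel_neq[OF distributed_sinr[OF assms(1-7)], of x]
    by (intro emeasure_eq_AE) auto
  then show ?thesis using emeasure_sinr_gt[OF assms] by simp
qed

text \<open>The gains are constrained only through their laws, so positivity can hold almost surely
  at best. It follows because the tail at 0 equals 1.\<close>

lemma (in prob_space) AE_sinr_pos:
  fixes X Y :: "'a \<Rightarrow> real"
  assumes ind: "indep_var borel X borel Y"
    and X: "exponential_rv M X \<Omega>\<^sub>X" and Y: "exponential_rv M Y \<Omega>\<^sub>Y"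
    and pos: "0 < \<Omega>\<^sub>X" "0 < \<Omega>\<^sub>Y" "0 < c" "0 < d"
  shows "AE \<omega> in M. 0 < c * X \<omega> / (d * Y \<omega> + 1)"
proof -
  have [measurable]: "random_variable borel X" "random_variable borel Y"
    using indep_var_rv1[OF ind] indep_var_rv2[OF ind] by auto
  have "prob {\<omega> \<in> space M. 0 < c * X \<omega> / (d * Y \<omega> + 1)} = 1"
    using emeasure_sinr_gt[OF assms order_refl] by (simp add: sinr_ccdf_def emeasure_eq_measure)
  then show ?thesis by (subst (asm) prob_Collect_eq_1) auto
qed

section \<open>The outage event as a linear inequality between the SINRs\<close>

lemma secrecy_capacity_less_iff:
  assumes "0 < B" "0 < R" "0 < p" "0 < e"
  shows "secrecy_capacity B p e < R \<longleftrightarrow> \<not> 2 powr (R / B) - 1 + 2 powr (R / B) * e \<le> p"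
proof -
  have \<xi>: "1 < 2 powr (R / B)" using assms by (simp add: gr_one_powr)
  \<comment> \<open>Since \<open>0 < R\<close>, the branch with capacity 0 always counts as
    outage.\<close>
  have "secrecy_capacity B p e < R \<longleftrightarrow> \<not> (e \<le> p \<and> R / B \<le> log 2 (1 + p) - log 2 (1 + e))"
    using assms by (auto simp: secrecy_capacity_def field_simps)
  also have "log 2 (1 + p) - log 2 (1 + e) = log 2 ((1 + p) / (1 + e))"
    using assms by (subst log_divide) auto
  also have "R / B \<le> log 2 ((1 + p) / (1 + e)) \<longleftrightarrow> 2 powr (R / B) \<le> (1 + p) / (1 + e)"
    using assms by (subst le_log_iff) auto
  also have "\<dots> \<longleftrightarrow> 2 powr (R / B) - 1 + 2 powr (R / B) * e \<le> p"
    using assms by (simp add: field_simps)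
  also have "e \<le> p \<and> 2 powr (R / B) - 1 + 2 powr (R / B) * e \<le> p \<longleftrightarrow>
      2 powr (R / B) - 1 + 2 powr (R / B) * e \<le> p"
  proof -
    \<comment> \<open>This product is the threshold minus \<open>e\<close>. Its nonnegativity makes
      the condition \<open>e \<le> p\<close> redundant, so the case distinction in the capacity
      disappears.\<close>
    have "0 \<le> (2 powr (R / B) - 1) * (1 + e)"
      by (intro mult_nonneg_nonneg) (use \<xi> assms in linarith)+
    also have "\<dots> = 2 powr (R / B) - 1 + 2 powr (R / B) * e - e" by (simp add: algebra_simps)
    finally show ?thesis by auto
  qed
  finally show ?thesis .
qed

section \<open>The integrals to which the outage probability reduces\<close>

text \<open>The denominator is at least 1 on the half-line, so the integrand is dominated by
  \<open>exp (- (s * y))\<close>.\<close>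

lemma set_integrable_exp_over_linear_power:
  fixes s D :: real
  assumes "0 < s" "0 < D"
  shows "set_integrable lborel {0..} (\<lambda>y. exp (- (s * y)) / (1 + D * y) ^ n)"
proof -
  have fin: "integrable lborel (\<lambda>y. indicator {0..} y * exp (- (s * y)))"
    using nn_integral_exponential_tail[of s 1] assms
    by (intro integrableI_nonneg) (auto simp: ennreal_mult' mult.commute ennreal_indicator)
  show ?thesis
    unfolding set_integrable_def real_scaleR_def
  proof (rule Bochner_Integration.integrable_bound[OF fin])
    show "AE y in lborel. norm (indicator {0..} y * (exp (- (s * y)) / (1 + D * y) ^ n))
        \<le> norm (indicator {0..} y * exp (- (s * y)))"
    proof (rule AE_I2)
      fix y :: real
      show "norm (indicator {0..} y * (exp (- (s * y)) / (1 + D * y) ^ n)) \<le> norm (indicator {0..} y * exp (- (s * y)))"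
      proof (cases "0 \<le> y")
        case True
        then have "1 \<le> (1 + D * y) ^ n" using assms by (intro one_le_power) auto
        then have "exp (- (s * y)) / (1 + D * y) ^ n \<le> exp (- (s * y)) / 1"
          by (intro divide_left_mono) auto
        then show ?thesis using True assms by (simp add: indicator_def)
      qed simp
    qed
  qed measurable
qed

text \<open>For positive \<open>s\<close> and \<open>D\<close> this is a rescaled generalized
  exponential integral: \<open>exp (s / D) / D\<close> times E_n at \<open>s / D\<close>, as the
  substitution t = 1 + D y shows.\<close>

definition exp_int :: "nat \<Rightarrow> real \<Rightarrow> real \<Rightarrow> real" where
  "exp_int n s D = (LBINT y:{0..}. exp (- (s * y)) / (1 + D * y) ^ n)"

lemma exp_int_1:
  assumes "0 < s" "0 < D"
  shows "exp_int 1 s D = exp (s / D) * Gamma0 (s / D) / D"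
proof -
  have "Gamma0 (s / D) = s * (\<integral>y. indicator {s / D<..} (s / D + s * y) * (exp (- (s / D + s * y)) / (s / D + s * y)) \<partial>lborel)"
    unfolding Gamma0_def set_lebesgue_integral_def
    using assms by (subst lborel_integral_real_affine[of s _ "s / D"]) auto
  also have "(\<integral>y. indicator {s / D<..} (s / D + s * y) * (exp (- (s / D + s * y)) / (s / D + s * y)) \<partial>lborel) =
    (\<integral>y. exp (- (s / D)) * D / s * (indicator {0..} y * (exp (- (s * y)) / (1 + D * y))) \<partial>lborel)"
  proof (intro integral_cong_AE)
    \<comment> \<open>\<open>Gamma0\<close> integrates over an open half-line, which corresponds to
      \<open>0 < y\<close>, while \<open>exp_int\<close> includes 0. The integrands thus agree only
      off the null set consisting of 0.\<close>
    show "AE y in lborel. indicator {s / D<..} (s / D + s * y) * (exp (- (s / D + s * y)) / (s / D + s * y)) =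
      exp (- (s / D)) * D / s * (indicator {0..} y * (exp (- (s * y)) / (1 + D * y)))"
      using AE_lborel_singleton[of "0::real"]
    proof eventually_elim
      case (elim y)
      show ?case
      proof (cases "0 < y")
        case True
        have "s / D + s * y = s / D * (1 + D * y)" using assms by (simp add: field_simps)
        moreover have "exp (- (s / D + s * y)) = exp (- (s / D)) * exp (- (s * y))"
          by (simp flip: exp_add)
        moreover have "s / D + s * y \<in> {s / D<..}" "y \<in> {0..}" using True assms by auto
        ultimately show ?thesis using True assms by simp
      next
        case False
        with elim show ?thesis using assms by (auto simp: indicator_def zero_less_mult_iff)
      qed
    qed
  qed measurable
  also have "\<dots> = exp (- (s / D)) * D / s * exp_int 1 s D"
    by (simp only: exp_int_def set_lebesgue_integral_def real_scaleR_def power_one_right integral_mult_right_zero)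
  finally show ?thesis using assms by (simp add: exp_minus field_simps)
qed

lemma exp_int_Suc:
  assumes "0 < s" "0 < D" "0 < n"
  shows "exp_int (Suc n) s D = (1 - s * exp_int n s D) / (n * D)"
proof -
  let ?e = "\<lambda>n y. exp (- (s * y)) / (1 + D * y) ^ n"
  let ?f = "\<lambda>y. n * D * ?e (Suc n) y + s * ?e n y"
  note i = set_integrable_exp_over_linear_power[OF assms(1,2)]
  \<comment> \<open>\<open>?f\<close> is the derivative of \<open>- ?e n\<close>, so this is integration by parts.\<close>
  have "set_lebesgue_integral lborel {0..} ?f = 1"
  proof -
    have lim: "((\<lambda>y. - ?e n y) \<longlongrightarrow> - 0) at_top"
      using assms by real_asymp
    \<comment> \<open>The boundary terms are the limit 0 at infinity and the value -1 of
      \<open>- ?e n\<close> at 0, so the total is 1. As \<open>?f\<close> is nonnegative, the value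
      carries over to the Lebesgue integral.\<close>
    have "(\<integral>\<^sup>+y. ennreal (?f y) * indicator {0..} y \<partial>lborel) = ennreal (- 0 - (- ?e n 0))"
    proof (rule nn_integral_FTC_atLeast[OF _ _ _ lim])
      fix y :: real assume y: "0 \<le> y"
      then have p: "0 < 1 + D * y" using assms by (simp add: add_pos_nonneg)
      then show "0 \<le> ?f y" using assms by simp
      \<comment> \<open>The power rule produces the exponent \<open>n - Suc 0\<close>. Writing
        \<open>n = Suc m\<close> turns all powers into multiples of \<open>w = u ^ m\<close>, which
        leaves a rational identity in \<open>u\<close> and \<open>w\<close>.\<close>
      obtain m where m: "n = Suc m" using assms(3) by (cases n) auto
      define u w e where "u = 1 + D * y" and "w = u ^ m" and "e = exp (- (s * y))"
      have uw: "u \<noteq> 0" "w \<noteq> 0" using p by (auto simp: u_def w_def)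
      have "((\<lambda>y. 1 + D * y) has_real_derivative D) (at y)"
        "((\<lambda>y. exp (- (s * y))) has_real_derivative - s * e) (at y)"
        unfolding e_def by (auto intro!: derivative_eq_intros)
      note this(2) DERIV_power[OF this(1), of n]
      from DERIV_minus[OF DERIV_divide[OF this]] p
      have "((\<lambda>y. - ?e n y) has_real_derivative
          - ((- s * e * u ^ n - e * (n * (D * u ^ (n - Suc 0)))) / (u ^ n * u ^ n))) (at y)"
        by (simp add: u_def e_def)
      also have "- ((- s * e * u ^ n - e * (n * (D * u ^ (n - Suc 0)))) / (u ^ n * u ^ n)) =
          n * D * (e / u ^ Suc n) + s * (e / u ^ n)"
        unfolding m diff_Suc_Suc diff_zero power_Suc w_def[symmetric]
        using uw by (simp add: divide_simps) (simp add: algebra_simps)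
      finally show "((\<lambda>y. - ?e n y) has_real_derivative ?f y) (at y)"
        unfolding u_def e_def .
    qed measurable
    moreover have "(\<integral>\<^sup>+y. ennreal (indicator {0..} y * ?f y) \<partial>lborel) =
        (\<integral>\<^sup>+y. ennreal (?f y) * indicator {0..} y \<partial>lborel)"
      by (intro nn_integral_cong) (simp add: indicator_def)
    moreover have "set_lebesgue_integral lborel {0..} ?f =
        enn2real (\<integral>\<^sup>+y. ennreal (indicator {0..} y * ?f y) \<partial>lborel)"
      unfolding set_lebesgue_integral_def real_scaleR_def
    proof (rule integral_eq_nn_integral)
      show "AE y in lborel. 0 \<le> indicator {0..} y * ?f y"
        using assms by (intro AE_I2) (simp add: indicator_def)
    qed measurable
    ultimately show ?thesis by simp
  qed
  moreover have "set_lebesgue_integral lborel {0..} ?f = n * D * exp_int (Suc n) s D + s * exp_int n s D"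
    unfolding exp_int_def using i[of n] i[of "Suc n"]
    by (simp only: set_integral_add set_integrable_mult_right set_integral_mult_right simp_thms)
  ultimately show ?thesis using assms by (simp add: field_simps)
qed


section \<open>The outage probability as a one-dimensional integral\<close>

text \<open>Independence within each pair gives the laws of the two SINRs; independence between the
  SINRs allows conditioning on the eavesdropper's. The complementary event is computed because there
  the tail of the primary SINR applies directly.\<close>

lemma (in prob_space) secrecy_outage_eq_integral:
  fixes X Y U V :: "'a \<Rightarrow> real"
  assumes indP: "indep_var borel X borel Y" and indE: "indep_var borel U borel V"
    and ind: "indep_var borel (\<lambda>\<omega>. c * X \<omega> / (d * Y \<omega> + 1)) borel (\<lambda>\<omega>. c * U \<omega> / (d * V \<omega> + 1))"
    and X: "exponential_rv M X \<Omega>\<^sub>X" and Y: "exponential_rv M Y \<Omega>\<^sub>Y"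
    and U: "exponential_rv M U \<Omega>\<^sub>U" and V: "exponential_rv M V \<Omega>\<^sub>V"
    and pos: "0 < \<Omega>\<^sub>X" "0 < \<Omega>\<^sub>Y" "0 < \<Omega>\<^sub>U" "0 < \<Omega>\<^sub>V" "0 < c" "0 < d" "0 < B" "0 < R"
  shows "secrecy_outage M B R (\<lambda>\<omega>. c * X \<omega> / (d * Y \<omega> + 1)) (\<lambda>\<omega>. c * U \<omega> / (d * V \<omega> + 1)) =
    1 - (LBINT y:{0..}. sinr_pdf (c * \<Omega>\<^sub>U) (d * \<Omega>\<^sub>V / (c * \<Omega>\<^sub>U)) y *
      sinr_ccdf (c * \<Omega>\<^sub>X) (d * \<Omega>\<^sub>Y / (c * \<Omega>\<^sub>X)) (2 powr (R / B) - 1 + 2 powr (R / B) * y))"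
proof -
  define \<xi> where "\<xi> = 2 powr (R / B)"
  let ?P = "\<lambda>\<omega>. c * X \<omega> / (d * Y \<omega> + 1)" and ?E = "\<lambda>\<omega>. c * U \<omega> / (d * V \<omega> + 1)"
  let ?p = "sinr_pdf (c * \<Omega>\<^sub>U) (d * \<Omega>\<^sub>V / (c * \<Omega>\<^sub>U))"
  let ?S = "\<lambda>y. sinr_ccdf (c * \<Omega>\<^sub>X) (d * \<Omega>\<^sub>Y / (c * \<Omega>\<^sub>X)) (\<xi> - 1 + \<xi> * y)"
  have \<xi>: "1 < \<xi>" using pos by (simp add: \<xi>_def gr_one_powr)
  \<comment> \<open>The tail formula is valid only for nonnegative thresholds.\<close>
  have t: "0 \<le> \<xi> - 1 + \<xi> * y" if "0 \<le> y" for y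
    using \<xi> that by (intro add_nonneg_nonneg) auto
  have [measurable]: "random_variable borel X" "random_variable borel Y"
      "random_variable borel U" "random_variable borel V"
    using indP indE by (auto dest: indep_var_rv1 indep_var_rv2)
  have nn: "0 \<le> ?p y * ?S y" if "0 \<le> y" for y
    using that pos t[OF that] by (intro mult_nonneg_nonneg sinr_pdf_nonneg sinr_ccdf_nonneg) auto
  have "emeasure M {\<omega> \<in> space M. \<xi> - 1 + \<xi> * ?E \<omega> \<le> ?P \<omega>} =
      (\<integral>\<^sup>+y. ennreal (?p y * ?S y) * indicator {0..} y \<partial>lborel)"
  proof (rule emeasure_indep_rel_density[OF ind])
    show "distributed M lborel ?E (\<lambda>y. indicator {0..} y * ?p y)"
      by (rule distributed_sinr[OF indE U V pos(3-6)])
    show "0 \<le> ?p y" if "0 \<le> y" for y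
      using pos that by (intro sinr_pdf_nonneg) auto
    show "emeasure M {\<omega> \<in> space M. \<xi> - 1 + \<xi> * y \<le> ?P \<omega>} = ennreal (?S y)" if "0 \<le> y" for y
      by (rule emeasure_sinr_ge[OF indP X Y pos(1,2,5,6) t[OF that]])
  qed measurable
  also have "\<dots> = (\<integral>\<^sup>+y. ennreal (indicator {0..} y * (?p y * ?S y)) \<partial>lborel)"
    by (intro nn_integral_cong) (auto split: split_indicator)
  finally have "prob {\<omega> \<in> space M. \<xi> - 1 + \<xi> * ?E \<omega> \<le> ?P \<omega>} =
      enn2real (\<integral>\<^sup>+y. ennreal (indicator {0..} y * (?p y * ?S y)) \<partial>lborel)"
    by (simp only: measure_def)
  also have "\<dots> = (LBINT y:{0..}. ?p y * ?S y)"
    unfolding set_lebesgue_integral_def real_scaleR_def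
  proof (rule integral_eq_nn_integral[symmetric])
    show "AE y in lborel. 0 \<le> indicator {0..} y * (?p y * ?S y)"
      using nn by (intro AE_I2) (simp add: indicator_def)
  qed measurable
  finally have secure: "prob {\<omega> \<in> space M. \<xi> - 1 + \<xi> * ?E \<omega> \<le> ?P \<omega>} =
      (LBINT y:{0..}. ?p y * ?S y)" .
  have "{\<omega> \<in> space M. \<xi> - 1 + \<xi> * ?E \<omega> \<le> ?P \<omega>} \<in> events" by measurable
  from prob_neg[OF this]
  have "prob {\<omega> \<in> space M. \<not> \<xi> - 1 + \<xi> * ?E \<omega> \<le> ?P \<omega>} =
      1 - (LBINT y:{0..}. ?p y * ?S y)"
    unfolding secure .
  moreover have "secrecy_outage M B R ?P ?E = prob {\<omega> \<in> space M. \<not> \<xi> - 1 + \<xi> * ?E \<omega> \<le> ?P \<omega>}"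
    unfolding secrecy_outage_def
  \<comment> \<open>The two events need only agree almost surely, because the reformulation of
    outage requires both SINRs to be positive.\<close>
  proof (rule measure_eq_AE)
    show "AE \<omega> in M. \<omega> \<in> {\<omega> \<in> space M. secrecy_capacity B (?P \<omega>) (?E \<omega>) < R} \<longleftrightarrow>
        \<omega> \<in> {\<omega> \<in> space M. \<not> \<xi> - 1 + \<xi> * ?E \<omega> \<le> ?P \<omega>}"
      using AE_sinr_pos[OF indP X Y pos(1,2,5,6)] AE_sinr_pos[OF indE U V pos(3,4,5,6)]
    proof eventually_elim
      case (elim \<omega>)
      then show ?case
        unfolding mem_Collect_eq \<xi>_def by (subst secrecy_capacity_less_iff[OF pos(7,8)]) (rule refl | assumption)+
    qed
  next
    have "(\<lambda>\<omega>. secrecy_capacity B (?P \<omega>) (?E \<omega>)) \<in> borel_measurable M"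
      unfolding secrecy_capacity_def by measurable
    then show "{\<omega> \<in> space M. secrecy_capacity B (?P \<omega>) (?E \<omega>) < R} \<in> events"
      by measurable
  qed measurable
  ultimately show ?thesis
    by (simp only: \<xi>_def)
qed

section \<open>Normal form and partial fractions of the integrand\<close>

text \<open>This is where the constants of the theorem originate. Pulling the denominator's value
  \<open>q\<close> at \<open>y = 0\<close> out of the tail leaves \<open>1 + D\<^sub>1 * y\<close>;
  the factors independent of \<open>y\<close> form \<open>A\<^sub>1\<close>, and the two decay rates
  add up to \<open>s\<close>, the later \<open>1 / B\<^sub>1\<close>.\<close>

lemma sinr_pdf_times_ccdf:
  fixes B\<^sub>0 A\<^sub>0 E\<^sub>0 D\<^sub>0 \<xi> y :: real
  assumes pos: "0 < B\<^sub>0" "0 < A\<^sub>0" "0 < E\<^sub>0" "0 < D\<^sub>0" "1 < \<xi>" and y: "0 \<le> y"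
  defines "A\<^sub>1 \<equiv> exp (- ((\<xi> - 1) / B\<^sub>0)) / (1 + A\<^sub>0 * (\<xi> - 1))"
    and "D\<^sub>1 \<equiv> A\<^sub>0 * \<xi> / (1 + A\<^sub>0 * (\<xi> - 1))"
    and "s \<equiv> \<xi> / B\<^sub>0 + 1 / E\<^sub>0"
  shows "sinr_pdf E\<^sub>0 D\<^sub>0 y * sinr_ccdf B\<^sub>0 A\<^sub>0 (\<xi> - 1 + \<xi> * y) =
    A\<^sub>1 * (exp (- (s * y)) / (1 + D\<^sub>1 * y) * (1 / E\<^sub>0 / (1 + D\<^sub>0 * y) + D\<^sub>0 / (1 + D\<^sub>0 * y)\<^sup>2))"
proof -
  define q where "q = 1 + A\<^sub>0 * (\<xi> - 1)"
  have q: "0 < q" using pos by (simp add: q_def add_pos_nonneg)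
  have "1 + A\<^sub>0 * (\<xi> - 1 + \<xi> * y) = q + A\<^sub>0 * \<xi> * y"
    unfolding q_def by (simp add: algebra_simps)
  also have "\<dots> = q * (1 + D\<^sub>1 * y)"
    using q unfolding D\<^sub>1_def q_def[symmetric] by (simp add: field_simps)
  finally have den: "1 + A\<^sub>0 * (\<xi> - 1 + \<xi> * y) = q * (1 + D\<^sub>1 * y)" .
  have "- ((\<xi> - 1 + \<xi> * y) / B\<^sub>0) + - (y / E\<^sub>0) = - ((\<xi> - 1) / B\<^sub>0) + - (s * y)"
    using pos unfolding s_def by (simp add: field_simps)
  then have ex: "exp (- ((\<xi> - 1 + \<xi> * y) / B\<^sub>0)) * exp (- (y / E\<^sub>0)) = exp (- ((\<xi> - 1) / B\<^sub>0)) * exp (- (s * y))"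
    by (simp only: exp_add[symmetric])
  define K where "K = 1 / E\<^sub>0 / (1 + D\<^sub>0 * y) + D\<^sub>0 / (1 + D\<^sub>0 * y)\<^sup>2"
  have "sinr_pdf E\<^sub>0 D\<^sub>0 y * sinr_ccdf B\<^sub>0 A\<^sub>0 (\<xi> - 1 + \<xi> * y) =
      (exp (- ((\<xi> - 1 + \<xi> * y) / B\<^sub>0)) * exp (- (y / E\<^sub>0))) * K / (q * (1 + D\<^sub>1 * y))"
    unfolding sinr_pdf_def sinr_ccdf_def den K_def[symmetric] by simp
  then show ?thesis
    unfolding ex A\<^sub>1_def q_def[symmetric] K_def[symmetric] by simp
qed

text \<open>With equal slopes the linear factors merge into pure second and third powers, so no
  partial fractions are needed. The parameter \<open>e\<close> stands for
  \<open>1 / E\<^sub>0\<close>.\<close>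

lemma integral_exp_linear_same:
  fixes s D e :: real
  assumes "0 < s" "0 < D"
  shows "(LBINT y:{0..}. exp (- (s * y)) / (1 + D * y) * (e / (1 + D * y) + D / (1 + D * y)\<^sup>2)) =
    e * exp_int 2 s D + D * exp_int 3 s D"
proof -
  note i = set_integrable_exp_over_linear_power[OF assms]
  have "(LBINT y:{0..}. exp (- (s * y)) / (1 + D * y) * (e / (1 + D * y) + D / (1 + D * y)\<^sup>2)) =
    (LBINT y:{0..}. e * (exp (- (s * y)) / (1 + D * y) ^ 2) + D * (exp (- (s * y)) / (1 + D * y) ^ 3))"
    by (intro set_lebesgue_integral_cong) (auto simp: power2_eq_square power3_eq_cube algebra_simps)
  also have "\<dots> = e * exp_int 2 s D + D * exp_int 3 s D"
    unfolding exp_int_def using i[of 2] i[of 3]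
    by (simp only: set_integral_add set_integrable_mult_right set_integral_mult_right simp_thms)
  finally show ?thesis .
qed

lemma integral_exp_linear_distinct:
  fixes s D\<^sub>0 D\<^sub>1 e :: real
  assumes pos: "0 < s" "0 < D\<^sub>0" "0 < D\<^sub>1" and ne: "D\<^sub>1 \<noteq> D\<^sub>0"
  shows "(LBINT y:{0..}. exp (- (s * y)) / (1 + D\<^sub>1 * y) * (e / (1 + D\<^sub>0 * y) + D\<^sub>0 / (1 + D\<^sub>0 * y)\<^sup>2)) =
    D\<^sub>0\<^sup>2 / (D\<^sub>0 - D\<^sub>1) * exp_int 2 s D\<^sub>0
    + (e / (D\<^sub>0 - D\<^sub>1) - D\<^sub>0 * D\<^sub>1 / (D\<^sub>0 - D\<^sub>1)\<^sup>2) * (D\<^sub>0 * exp_int 1 s D\<^sub>0 - D\<^sub>1 * exp_int 1 s D\<^sub>1)"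
proof -
  note i = set_integrable_exp_over_linear_power[OF pos(1,2)] set_integrable_exp_over_linear_power[OF pos(1,3)]
  let ?k = "e / (D\<^sub>0 - D\<^sub>1) - D\<^sub>0 * D\<^sub>1 / (D\<^sub>0 - D\<^sub>1)\<^sup>2"
  let ?E = "\<lambda>n D y. exp (- (s * y)) / (1 + D * y) ^ n"
  have "(LBINT y:{0..}. exp (- (s * y)) / (1 + D\<^sub>1 * y) * (e / (1 + D\<^sub>0 * y) + D\<^sub>0 / (1 + D\<^sub>0 * y)\<^sup>2)) =
    (LBINT y:{0..}. D\<^sub>0\<^sup>2 / (D\<^sub>0 - D\<^sub>1) * ?E 2 D\<^sub>0 y + (?k * D\<^sub>0 * ?E 1 D\<^sub>0 y - ?k * D\<^sub>1 * ?E 1 D\<^sub>1 y))"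
  proof (intro set_lebesgue_integral_cong, goal_cases)
    case (2)
    show ?case
    proof (intro allI impI)
      fix y :: real assume "y \<in> {0..}"
      then have p: "0 < 1 + D\<^sub>0 * y" "0 < 1 + D\<^sub>1 * y" using pos by (auto simp: add_pos_nonneg)
      define u v \<delta> where "u = 1 + D\<^sub>0 * y" and "v = 1 + D\<^sub>1 * y" and "\<delta> = D\<^sub>0 - D\<^sub>1"
      have uv: "u \<noteq> 0" "v \<noteq> 0" "\<delta> \<noteq> 0" using p ne by (auto simp: u_def v_def \<delta>_def)
      \<comment> \<open>Partial fractions: \<open>D\<^sub>0 * v - D\<^sub>1 * u\<close> is the
        constant \<open>\<delta>\<close>.\<close>
      have "1 / v * (1 / u) = (D\<^sub>0 / u - D\<^sub>1 / v) / \<delta>"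
        using uv by (simp add: divide_simps) (simp add: u_def v_def \<delta>_def algebra_simps)
      note p1 = this
      \<comment> \<open>The previous identity multiplied by \<open>1 / u\<close>; substituting that
        identity once more removes the remaining mixed product.\<close>
      have p2: "1 / v * (1 / u\<^sup>2) = D\<^sub>0 / \<delta> / u\<^sup>2 - D\<^sub>1 / \<delta> * (1 / v * (1 / u))"
        using uv by (simp add: divide_simps power2_eq_square) (simp add: u_def v_def \<delta>_def algebra_simps)
      have "1 / v * (e / u + D\<^sub>0 / u\<^sup>2) = e * (1 / v * (1 / u)) + D\<^sub>0 * (1 / v * (1 / u\<^sup>2))"
        by (simp add: algebra_simps)
      also have "\<dots> =
          e * ((D\<^sub>0 / u - D\<^sub>1 / v) / \<delta>) + D\<^sub>0 * (D\<^sub>0 / \<delta> / u\<^sup>2 - D\<^sub>1 / \<delta> * ((D\<^sub>0 / u - D\<^sub>1 / v) / \<delta>))"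
        unfolding p2 p1 ..
      also have "\<dots> = D\<^sub>0\<^sup>2 / \<delta> / u\<^sup>2 + (e / \<delta> - D\<^sub>0 * D\<^sub>1 / \<delta>\<^sup>2) * (D\<^sub>0 / u - D\<^sub>1 / v)"
        by (simp add: power2_eq_square algebra_simps add_divide_distrib diff_divide_distrib)
      finally have "exp (- (s * y)) * (1 / v * (e / u + D\<^sub>0 / u\<^sup>2)) =
          exp (- (s * y)) * (D\<^sub>0\<^sup>2 / \<delta> / u\<^sup>2 + (e / \<delta> - D\<^sub>0 * D\<^sub>1 / \<delta>\<^sup>2) * (D\<^sub>0 / u - D\<^sub>1 / v))"
        by simp
      then show "exp (- (s * y)) / (1 + D\<^sub>1 * y) * (e / (1 + D\<^sub>0 * y) + D\<^sub>0 / (1 + D\<^sub>0 * y)\<^sup>2) =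
          D\<^sub>0\<^sup>2 / (D\<^sub>0 - D\<^sub>1) * ?E 2 D\<^sub>0 y + (?k * D\<^sub>0 * ?E 1 D\<^sub>0 y - ?k * D\<^sub>1 * ?E 1 D\<^sub>1 y)"
        unfolding u_def[symmetric] v_def[symmetric] \<delta>_def[symmetric] power_one_right
        by (simp add: algebra_simps add_divide_distrib diff_divide_distrib)
    qed
  qed simp
  also have "\<dots> = D\<^sub>0\<^sup>2 / (D\<^sub>0 - D\<^sub>1) * exp_int 2 s D\<^sub>0 + (?k * D\<^sub>0 * exp_int 1 s D\<^sub>0 - ?k * D\<^sub>1 * exp_int 1 s D\<^sub>1)"
    unfolding exp_int_def using i(1)[of 1] i(1)[of 2] i(2)[of 1]
    by (simp only: set_integral_add set_integral_diff set_integrable_mult_right set_integral_mult_right simp_thms)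
  finally show ?thesis by (simp add: algebra_simps)
qed

section \<open>Assembling the two closed forms\<close>

theorem mainTheorem4:
  fixes M :: "'a measure"
    and h \<alpha> f \<phi> \<gamma>\<^sub>P \<gamma>\<^sub>E :: "'a \<Rightarrow> real"
    and P\<^sub>p N\<^sub>0 B r\<^sub>p P\<^sub>p\<^sub>k \<theta>\<^sub>t\<^sub>h R\<^sub>s :: real
    and \<Omega>\<^sub>h \<Omega>\<^sub>\<alpha> \<Omega>\<^sub>f \<Omega>\<^sub>\<phi> :: real
    and P c d \<xi> A\<^sub>0 B\<^sub>0 D\<^sub>0 E\<^sub>0 A\<^sub>1 B\<^sub>1 D\<^sub>1 P_out_sec :: real
  assumes "prob_space M"
    and "P\<^sub>p > 0" "N\<^sub>0 > 0" "B > 0" "r\<^sub>p > 0" "P\<^sub>p\<^sub>k > 0" "0 < \<theta>\<^sub>t\<^sub>h" "\<theta>\<^sub>t\<^sub>h < 1"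
    and "\<Omega>\<^sub>h > 0" "\<Omega>\<^sub>\<alpha> > 0" "\<Omega>\<^sub>f > 0" "\<Omega>\<^sub>\<phi> > 0"
    and "prob_space.indep_vars M (\<lambda>_. borel) (\<lambda>i. [h, \<alpha>, f, \<phi>] ! i) {..<4::nat}"
    and "exponential_rv M h \<Omega>\<^sub>h" "exponential_rv M \<alpha> \<Omega>\<^sub>\<alpha>"
    and "exponential_rv M f \<Omega>\<^sub>f" "exponential_rv M \<phi> \<Omega>\<^sub>\<phi>"
    and "P = secondary_power P\<^sub>p N\<^sub>0 B r\<^sub>p P\<^sub>p\<^sub>k \<theta>\<^sub>t\<^sub>h \<Omega>\<^sub>h \<Omega>\<^sub>\<alpha>"
    and "P > 0" and "R\<^sub>s > 0"
    and "c = P\<^sub>p / N\<^sub>0" and "d = P / N\<^sub>0"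
    and "\<gamma>\<^sub>P = (\<lambda>\<omega>. c * h \<omega> / (d * \<alpha> \<omega> + 1))"
    and "\<gamma>\<^sub>E = (\<lambda>\<omega>. c * f \<omega> / (d * \<phi> \<omega> + 1))"
    and "P_out_sec = secrecy_outage M B R\<^sub>s \<gamma>\<^sub>P \<gamma>\<^sub>E"
    and "\<xi> = 2 powr (R\<^sub>s / B)"
    and "A\<^sub>0 = d * \<Omega>\<^sub>\<alpha> / (c * \<Omega>\<^sub>h)" and "B\<^sub>0 = c * \<Omega>\<^sub>h"
    and "D\<^sub>0 = d * \<Omega>\<^sub>\<phi> / (c * \<Omega>\<^sub>f)" and "E\<^sub>0 = c * \<Omega>\<^sub>f"
    and "A\<^sub>1 = exp (- ((\<xi> - 1) / B\<^sub>0)) / (1 + A\<^sub>0 * (\<xi> - 1))"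
    and "D\<^sub>1 = A\<^sub>0 * \<xi> / (1 + A\<^sub>0 * (\<xi> - 1))"
    and "1 / B\<^sub>1 = \<xi> / B\<^sub>0 + 1 / E\<^sub>0"
  shows
    "(D\<^sub>1 = D\<^sub>0 \<longrightarrow>
       P_out_sec =
         1 - A\<^sub>1 / 2 + A\<^sub>1 / (2 * D\<^sub>0 * B\<^sub>1)
         - A\<^sub>1 / (2 * D\<^sub>0^2 * B\<^sub>1^2) * exp (1 / (D\<^sub>0 * B\<^sub>1)) * Gamma0 (1 / (D\<^sub>0 * B\<^sub>1))
         - A\<^sub>1 / (D\<^sub>0 * E\<^sub>0)
         - A\<^sub>1 / (D\<^sub>0^2 * E\<^sub>0 * B\<^sub>1) * exp (1 / (D\<^sub>0 * B\<^sub>1)) * Ei (- (1 / (D\<^sub>0 * B\<^sub>1))))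
     \<and>
     (D\<^sub>1 \<noteq> D\<^sub>0 \<longrightarrow>
       P_out_sec =
         1 - D\<^sub>0 * A\<^sub>1 / (D\<^sub>0 - D\<^sub>1)
         - A\<^sub>1 / (B\<^sub>1 * (D\<^sub>0 - D\<^sub>1)) * exp (1 / (D\<^sub>0 * B\<^sub>1)) * Ei (- (1 / (D\<^sub>0 * B\<^sub>1)))
         + A\<^sub>1 * D\<^sub>0 * D\<^sub>1 / (D\<^sub>0 - D\<^sub>1)^2 *
             (exp (1 / (D\<^sub>0 * B\<^sub>1)) * Gamma0 (1 / (D\<^sub>0 * B\<^sub>1))
              - exp (1 / (B\<^sub>1 * D\<^sub>1)) * Gamma0 (1 / (B\<^sub>1 * D\<^sub>1)))
         + A\<^sub>1 / (E\<^sub>0 * (D\<^sub>0 - D\<^sub>1)) *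
             (exp (1 / (B\<^sub>1 * D\<^sub>1)) * Gamma0 (1 / (B\<^sub>1 * D\<^sub>1))
              - exp (1 / (D\<^sub>0 * B\<^sub>1)) * Gamma0 (1 / (D\<^sub>0 * B\<^sub>1))))"
proof -
  interpret prob_space M by fact
  have h: "exponential_rv M h \<Omega>\<^sub>h" and \<alpha>: "exponential_rv M \<alpha> \<Omega>\<^sub>\<alpha>"
    and f: "exponential_rv M f \<Omega>\<^sub>f" and \<phi>: "exponential_rv M \<phi> \<Omega>\<^sub>\<phi>" by fact+
  have pos: "0 < \<Omega>\<^sub>h" "0 < \<Omega>\<^sub>\<alpha>" "0 < \<Omega>\<^sub>f" "0 < \<Omega>\<^sub>\<phi>" "0 < c" "0 < d" "0 < B" "0 < R\<^sub>s"
    using \<open>c = _\<close> \<open>d = _\<close> by (auto intro: assms divide_pos_pos)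
  have abde: "0 < A\<^sub>0" "0 < B\<^sub>0" "0 < D\<^sub>0" "0 < E\<^sub>0"
    using pos \<open>A\<^sub>0 = _\<close> \<open>B\<^sub>0 = _\<close> \<open>D\<^sub>0 = _\<close> \<open>E\<^sub>0 = _\<close> by simp_all
  have \<xi>: "1 < \<xi>" using pos \<open>\<xi> = _\<close> by (simp add: gr_one_powr)
  have D1: "0 < D\<^sub>1" using abde \<xi> \<open>D\<^sub>1 = _\<close> by (simp add: add_pos_nonneg)
  \<comment> \<open>\<open>B\<^sub>1\<close> is given only through its reciprocal, which is the
    decay rate of the integrals; positivity of the reciprocal also rules out
    \<open>B\<^sub>1 = 0\<close>.\<close>
  have B1: "0 < 1 / B\<^sub>1" unfolding \<open>1 / B\<^sub>1 = _\<close> using abde \<xi> by (simp add: add_pos_pos)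
  \<comment> \<open>Measurable functions of disjoint blocks of an independent family are
    independent. The blocks are chosen as single indices for the gains within one SINR, and as {0,
    1} and {2, 3} for the two SINRs.\<close>
  have ind: "indep_var borel (\<lambda>\<omega>. u (\<lambda>i\<in>I. ([h, \<alpha>, f, \<phi>] ! i) \<omega>)) borel (\<lambda>\<omega>. v (\<lambda>i\<in>J. ([h, \<alpha>, f, \<phi>] ! i) \<omega>))"
    if "I \<inter> J = {}" "I \<subseteq> {..<4}" "J \<subseteq> {..<4}"
      "u \<in> borel_measurable (PiM I (\<lambda>_. borel))" "v \<in> borel_measurable (PiM J (\<lambda>_. borel))"
    for u v :: "(nat \<Rightarrow> real) \<Rightarrow> real" and I J
    using indep_var_compose[OF indep_var_restrict[OF assms(13) that(1-3)] that(4,5)]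
    by (simp add: comp_def)
  have indP: "indep_var borel h borel \<alpha>"
    using ind[of "{0}" "{1}" "\<lambda>g. g 0" "\<lambda>g. g 1"] by simp
  have indE: "indep_var borel f borel \<phi>"
    using ind[of "{2}" "{3}" "\<lambda>g. g 2" "\<lambda>g. g 3"] by simp
  have indPE: "indep_var borel \<gamma>\<^sub>P borel \<gamma>\<^sub>E"
    unfolding \<open>\<gamma>\<^sub>P = _\<close> \<open>\<gamma>\<^sub>E = _\<close>
    using ind[of "{0, 1}" "{2, 3}" "\<lambda>g. c * g 0 / (d * g 1 + 1)" "\<lambda>g. c * g 2 / (d * g 3 + 1)"] by simp
  define J where "J = (LBINT y:{0..}. exp (- (1 / B\<^sub>1 * y)) / (1 + D\<^sub>1 * y) *
      (1 / E\<^sub>0 / (1 + D\<^sub>0 * y) + D\<^sub>0 / (1 + D\<^sub>0 * y)\<^sup>2))"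
  have "P_out_sec = 1 - (LBINT y:{0..}. sinr_pdf E\<^sub>0 D\<^sub>0 y * sinr_ccdf B\<^sub>0 A\<^sub>0 (\<xi> - 1 + \<xi> * y))"
    using secrecy_outage_eq_integral[OF indP indE _ h \<alpha> f \<phi> pos] indPE
    by (simp only: \<open>P_out_sec = _\<close> \<open>\<gamma>\<^sub>P = _\<close> \<open>\<gamma>\<^sub>E = _\<close> \<open>A\<^sub>0 = _\<close> \<open>B\<^sub>0 = _\<close> \<open>D\<^sub>0 = _\<close> \<open>E\<^sub>0 = _\<close> \<open>\<xi> = _\<close>)
  also have "(LBINT y:{0..}. sinr_pdf E\<^sub>0 D\<^sub>0 y * sinr_ccdf B\<^sub>0 A\<^sub>0 (\<xi> - 1 + \<xi> * y)) =
      (LBINT y:{0..}. A\<^sub>1 * (exp (- (1 / B\<^sub>1 * y)) / (1 + D\<^sub>1 * y) *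
        (1 / E\<^sub>0 / (1 + D\<^sub>0 * y) + D\<^sub>0 / (1 + D\<^sub>0 * y)\<^sup>2)))"
    using sinr_pdf_times_ccdf[OF abde(2,1,4,3) \<xi>]
    unfolding \<open>1 / B\<^sub>1 = _\<close> \<open>A\<^sub>1 = _\<close> \<open>D\<^sub>1 = _\<close>
    by (intro set_lebesgue_integral_cong) auto
  also have "\<dots> = A\<^sub>1 * J"
    unfolding J_def by (rule set_integral_mult_right)
  finally have out: "P_out_sec = 1 - A\<^sub>1 * J" .
  \<comment> \<open>Together with the recurrence at n = 1 and n = 2, this expresses every integral
    that occurs through \<open>Gamma0\<close>.\<close>
  have I1: "exp_int 1 (1 / B\<^sub>1) D = exp (1 / (B\<^sub>1 * D)) * Gamma0 (1 / (B\<^sub>1 * D)) / D" if "0 < D" for D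
    using exp_int_1[OF B1 that] by simp
  have I2: "exp_int 2 (1 / B\<^sub>1) D = (1 - 1 / B\<^sub>1 * exp_int 1 (1 / B\<^sub>1) D) / D" if "0 < D" for D
    using exp_int_Suc[OF B1 that, of 1] by (simp add: numeral_2_eq_2)
  have I3: "exp_int 3 (1 / B\<^sub>1) D = (1 - 1 / B\<^sub>1 * exp_int 2 (1 / B\<^sub>1) D) / (2 * D)" if "0 < D" for D
    using exp_int_Suc[OF B1 that, of 2] by (simp add: numeral_3_eq_3 numeral_2_eq_2)
  have nz: "B\<^sub>1 \<noteq> 0" "D\<^sub>0 \<noteq> 0" "D\<^sub>1 \<noteq> 0" "E\<^sub>0 \<noteq> 0" using B1 abde D1 by auto
  define G\<^sub>0 where "G\<^sub>0 = Gamma0 (1 / (D\<^sub>0 * B\<^sub>1))"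
  define G\<^sub>1 where "G\<^sub>1 = Gamma0 (1 / (B\<^sub>1 * D\<^sub>1))"
  define e\<^sub>0 where "e\<^sub>0 = exp (1 / (D\<^sub>0 * B\<^sub>1))"
  define e\<^sub>1 where "e\<^sub>1 = exp (1 / (B\<^sub>1 * D\<^sub>1))"
  have I10: "exp_int 1 (1 / B\<^sub>1) D\<^sub>0 = e\<^sub>0 * G\<^sub>0 / D\<^sub>0" and I11: "exp_int 1 (1 / B\<^sub>1) D\<^sub>1 = e\<^sub>1 * G\<^sub>1 / D\<^sub>1"
    using I1[OF abde(3)] I1[OF D1] by (simp_all add: G\<^sub>0_def G\<^sub>1_def e\<^sub>0_def e\<^sub>1_def mult.commute)
  note I20 = I2[OF abde(3), unfolded I10]
  note I30 = I3[OF abde(3), unfolded I20]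
  \<comment> \<open>The closed forms mix \<open>Ei\<close> and \<open>Gamma0\<close> at the same
    point; rewriting both with \<open>G\<^sub>0\<close> leaves rational identities in
    \<open>e\<^sub>0\<close>, \<open>G\<^sub>0\<close>, \<open>e\<^sub>1\<close>,
    \<open>G\<^sub>1\<close> and the constants.\<close>
  have Ei0: "Ei (- (1 / (D\<^sub>0 * B\<^sub>1))) = - G\<^sub>0" by (simp add: Ei_def G\<^sub>0_def)
  show ?thesis
    unfolding Ei0 G\<^sub>0_def[symmetric] G\<^sub>1_def[symmetric] e\<^sub>0_def[symmetric] e\<^sub>1_def[symmetric]
  proof (intro conjI impI, goal_cases)
    case 1
    have "J = 1 / E\<^sub>0 * exp_int 2 (1 / B\<^sub>1) D\<^sub>0 + D\<^sub>0 * exp_int 3 (1 / B\<^sub>1) D\<^sub>0"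
      unfolding J_def 1 by (rule integral_exp_linear_same[OF B1 abde(3)])
    also have "\<dots> = 1 / 2 - 1 / (2 * D\<^sub>0 * B\<^sub>1) + e\<^sub>0 * G\<^sub>0 / (2 * D\<^sub>0\<^sup>2 * B\<^sub>1\<^sup>2)
        + 1 / (D\<^sub>0 * E\<^sub>0) - e\<^sub>0 * G\<^sub>0 / (D\<^sub>0\<^sup>2 * E\<^sub>0 * B\<^sub>1)"
      unfolding I20 I30 using nz by (simp add: field_simps power2_eq_square)
    finally have J: "J = \<dots>" .
    show ?case
      unfolding out J by (simp add: algebra_simps)
  next
    case 2
    define \<delta> where "\<delta> = D\<^sub>0 - D\<^sub>1"
    have \<delta>: "\<delta> \<noteq> 0" using 2 by (simp add: \<delta>_def)
    have "J = D\<^sub>0\<^sup>2 / \<delta> * exp_int 2 (1 / B\<^sub>1) D\<^sub>0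
        + (1 / E\<^sub>0 / \<delta> - D\<^sub>0 * D\<^sub>1 / \<delta>\<^sup>2) * (D\<^sub>0 * exp_int 1 (1 / B\<^sub>1) D\<^sub>0 - D\<^sub>1 * exp_int 1 (1 / B\<^sub>1) D\<^sub>1)"
      unfolding J_def \<delta>_def by (rule integral_exp_linear_distinct[OF B1 abde(3) D1 2])
    also have "\<dots> = D\<^sub>0 / \<delta> - e\<^sub>0 * G\<^sub>0 / (B\<^sub>1 * \<delta>) + (1 / E\<^sub>0 / \<delta> - D\<^sub>0 * D\<^sub>1 / \<delta>\<^sup>2) * (e\<^sub>0 * G\<^sub>0 - e\<^sub>1 * G\<^sub>1)"
    proof -
      have "D\<^sub>0\<^sup>2 / \<delta> * exp_int 2 (1 / B\<^sub>1) D\<^sub>0 = D\<^sub>0 / \<delta> - e\<^sub>0 * G\<^sub>0 / (B\<^sub>1 * \<delta>)"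
        unfolding I20 using nz \<delta> by (simp add: field_simps power2_eq_square)
      then show ?thesis unfolding I10 I11 using nz by simp
    qed
    finally have J: "J = \<dots>" .
    show ?case
      unfolding out J \<delta>_def[symmetric] by (simp add: algebra_simps)
  qed
qed

end
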